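(* Let $q$ be a prime. For each prime $p \neq q$, let $S(p)$, $T(p)$, $A(p)$, $B(p)$ be sets of nonnegative integers with $S(p) \subseteq M(q) \subseteq T(p)$ and $A(p) \subseteq M^{c} (q) \subseteq B(p)$. Then \begin{align*} d(q) &\geq 1 - \left( 1- \tfrac{1}{q}\right) \prod_{p \neq q,\ p\text{ prime}} \left[1 - \left( 1-\tfrac{1}{p} \right )\sum_{s \in S(p)} \tfrac{1}{p^s} \right],\\ d(q) &\leq 1 - \left( 1- \tfrac{1}{q}\right) \prod_{p \neq q,\ p\text{ prime}} \left[1 - \left( 1-\tfrac{1}{p} \right )\sum_{t \in T(p)} \tfrac{1}{p^t} \right],\\ d(q) &\leq 1 - \left( 1- \tfrac{1}{q}\right) \prod_{p \neq q,\ p\text{ prime}} \left[\left( 1-\tfrac{1}{p} \right )\sum_{a \in A(p)} \tfrac{1}{p^a} \right],\\ d(q) &\geq 1 - \left( 1- \tfrac{1}{q}\right) \prod_{p \neq q,\ p\text{ prime}} \left[\left( 1-\tfrac{1}{p} \right )\sum_{b \in B(p)} \tfrac{1}{p^b} \right]. \end{align*}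
   Context: Tower factorization: the tower factorization of $1$ is $1$; if $n>1$ has prime factorization $n=p_1^{e_1}\cdots p_k^{e_k}$, its tower factorization is $\prod_{i=1}^k p_i^{(f_i)}$ where $f_i$ is the tower factorization of $e_i$ (recursively). A prime $q$ is contained in the tower factorization of $n$ if $q$ appears as one of the primes at any level of this recursive representation. For a prime $q$, $M(q)$ is the set of positive integers whose tower factorization contains $q$ (with $1\notin M(q)$, $0\notin M(q)$); $M^c(q) := \{z \in \{0,1,2,\ldots\} : z \notin M(q)\}$. $d(q) := \lim_{N\to\infty} |M(q)\cap\{1,\ldots,N\}|/N$ (this limit exists). *)

theory Defs
  imports "HOL-Analysis.Analysis" "HOL-Computational_Algebra.Computational_Algebra"
begin

text \<open>
  A tower is a formal product of prime powers whose exponents are again towers; the empty product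
  stands for \<open>1\<close>. The set function of the datatype, \<open>tower_primes\<close>, collects the bases occurring
  at all levels, not only the outermost one.
\<close>

datatype (tower_primes: 'a) tower = Tower "('a \<times> 'a tower) list"

lemma multiplicity_less_self:
  fixes n p :: nat
  assumes "p \<in> prime_factors n"
  shows "multiplicity p n < n"
proof -
  have "n > 0" and p: "prime p"
    using assms by (auto simp: in_prime_factors_iff)
  have "multiplicity p n < p ^ multiplicity p n"
    using prime_gt_1_nat[OF p] by (simp add: power_gt_expt)
  also have "\<dots> \<le> n"
    using \<open>n > 0\<close> by (intro dvd_imp_le multiplicity_dvd)
  finally show ?thesis .
qed

text \<open>
  The case \<open>n = 1\<close> yields the empty product, since \<open>1\<close> has no prime factors. The value at \<open>0\<close> is an
  irrelevant convention.
\<close>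

function tower_factorization :: "nat \<Rightarrow> nat tower" where
  "tower_factorization n =
     Tower (map (\<lambda>p. (p, tower_factorization (multiplicity p n)))
                (sorted_list_of_set (prime_factors n)))"
  by auto
termination
  by (relation "Wellfounded.measure id") (auto intro: multiplicity_less_self)

declare tower_factorization.simps [simp del]

lemma tower_primes_tower_factorization:
  "tower_primes (tower_factorization n) =
     (\<Union>p\<in>prime_factors n. insert p (tower_primes (tower_factorization (multiplicity p n))))"
  by (subst tower_factorization.simps) auto

definition M :: "nat \<Rightarrow> nat set" where
  "M q = {n. n > 0 \<and> q \<in> tower_primes (tower_factorization n)}"

definition Mc :: "nat \<Rightarrow> nat set" where
  "Mc q = {z. z \<notin> M q}"

definition d :: "nat \<Rightarrow> real" where
  "d q = lim (\<lambda>N. real (card (M q \<inter> {1..N})) / real N)"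

text \<open>
  Infinite products are limits of partial products, which may be \<open>0\<close>. The library's \<open>prodinf\<close> is
  not used because it leaves products that diverge to \<open>0\<close>, or that have infinitely many zero
  factors, unspecified. Such products do occur: consider the sets \<open>A p = {}\<close> for all \<open>p\<close>.
\<close>

definition prime_prod_except :: "nat \<Rightarrow> (nat \<Rightarrow> real) \<Rightarrow> real" where
  "prime_prod_except q F = lim (\<lambda>N. \<Prod>p | prime p \<and> p \<noteq> q \<and> p \<le> N. F p)"

lemma prime_prod_except_convergent:
  assumes "\<And>p. prime p \<Longrightarrow> p \<noteq> q \<Longrightarrow> 0 \<le> F p \<and> F p \<le> 1"
  shows "(\<lambda>N. \<Prod>p | prime p \<and> p \<noteq> q \<and> p \<le> N. F p) \<longlonglongrightarrow> prime_prod_except q F"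
proof -
  let ?P = "\<lambda>N. \<Prod>p | prime p \<and> p \<noteq> q \<and> p \<le> N. F p"
  have "decseq ?P"
  proof (rule antimonoI)
    fix m n :: nat
    assume "m \<le> n"
    define X where "X = (\<lambda>N. {p. prime p \<and> p \<noteq> q \<and> p \<le> N})"
    have sub: "X m \<subseteq> X n" and fin: "finite (X n)"
      using \<open>m \<le> n\<close> by (auto simp: X_def)
    have "prod F (X n) = prod F (X n - X m) * prod F (X m)"
      using sub fin by (rule prod.subset_diff)
    also have "\<dots> \<le> 1 * prod F (X m)"
      using assms by (intro mult_right_mono prod_le_1 prod_nonneg) (auto simp: X_def)
    finally show "?P n \<le> ?P m"
      by (simp add: X_def)
  qed
  moreover have "\<forall>N. 0 \<le> ?P N"
    using assms by (auto intro!: prod_nonneg)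
  ultimately obtain L where "?P \<longlonglongrightarrow> L"
    by (rule decseq_convergent)
  then have "convergent ?P"
    by (rule convergentI)
  then show ?thesis
    unfolding prime_prod_except_def by (simp add: convergent_LIMSEQ_iff)
qed

lemma prime_prod_except_eqI:
  assumes "(\<lambda>n. if prime n \<and> n \<noteq> q then F n else 1) has_prod P"
  shows "prime_prod_except q F = P"
proof -
  have "(\<lambda>N. \<Prod>n\<le>N. if prime n \<and> n \<noteq> q then F n else 1) \<longlonglongrightarrow> P"
    using assms by (rule has_prod_imp_tendsto)
  moreover have "(\<Prod>n\<le>N. if prime n \<and> n \<noteq> q then F n else 1) =
      (\<Prod>p | prime p \<and> p \<noteq> q \<and> p \<le> N. F p)" for N
    by (rule prod.mono_neutral_cong_right) auto
  ultimately show ?thesis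
    unfolding prime_prod_except_def by (simp add: limI)
qed

end

theory Submission
  imports Defs
begin

text \<open>
  A positive integer lies outside \<open>M q\<close> iff it is not divisible by \<open>q\<close> and all its exponents at the
  primes \<open>p \<noteq> q\<close> lie outside \<open>M q\<close>. Conditions on the exponents at finitely many primes are
  independent with respect to natural density, the exponent \<open>e\<close> at \<open>p\<close> having density
  \<open>(1 - 1 / p) / p ^ e\<close>. As \<open>0\<close> and \<open>1\<close> are not in \<open>M q\<close>, the condition at \<open>p\<close> can only fail for
  multiples of \<open>p\<^sup>2\<close>, so the condition at all primes \<open>p > y\<close> can be dropped at the cost of a density
  of at most \<open>1 / y\<close>. Hence \<open>1 - d q\<close> is the product of the local densities, and all four bounds
  follow from the monotonicity of the local densities in the set of admissible exponents.
\<close>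

text \<open>A predicate rather than a value of \<open>lim\<close>, so that existence of the natural
  density is part of what is proved.\<close>

definition has_density :: "nat set \<Rightarrow> real \<Rightarrow> bool" where
  "has_density X \<delta> \<longleftrightarrow> (\<lambda>N. real (card (X \<inter> {1..N})) / real N) \<longlonglongrightarrow> \<delta>"

text \<open>For prime \<open>p\<close>, the natural density of the integers whose exponent at
  \<open>p\<close> lies in \<open>E\<close>, written so that the factors in the theorem fold back
  into it.\<close>

definition local_density :: "nat \<Rightarrow> nat set \<Rightarrow> real" where
  "local_density p E = (1 - 1 / real p) * (\<Sum>\<^sub>\<infinity>e\<in>E. 1 / real p ^ e)"

subsection \<open>Local densities\<close>

lemma sums_inverse_powers:
  assumes "p \<ge> 2"
  shows "(\<lambda>e. 1 / real p ^ e) sums (1 / (1 - 1 / real p))"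
  using geometric_sums[of "1 / real p"] assms by (simp add: power_one_over)

lemma summable_on_inverse_powers:
  assumes "p \<ge> 2"
  shows "(\<lambda>e. 1 / real p ^ e) summable_on E"
proof (rule summable_on_subset_banach)
  show "(\<lambda>e. 1 / real p ^ e) summable_on UNIV"
    using sums_inverse_powers[OF assms]
    by (intro summable_nonneg_imp_summable_on) (auto simp: sums_iff)
qed auto

lemma local_density_UNIV:
  assumes "p \<ge> 2"
  shows "local_density p UNIV = 1"
proof -
  have "((\<lambda>e. 1 / real p ^ e) has_sum (1 / (1 - 1 / real p))) UNIV"
    using sums_inverse_powers[OF assms] by (intro sums_nonneg_imp_has_sum) auto
  then show ?thesis
    using assms by (simp add: local_density_def infsumI)
qed

lemma local_density_nonneg:
  assumes "p \<ge> 2"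
  shows "local_density p E \<ge> 0"
  using assms unfolding local_density_def by (intro mult_nonneg_nonneg infsum_nonneg) auto

lemma local_density_mono:
  assumes "p \<ge> 2" "E \<subseteq> E'"
  shows "local_density p E \<le> local_density p E'"
  using assms unfolding local_density_def
  by (intro mult_left_mono infsum_mono2 summable_on_inverse_powers) auto

lemma local_density_le_1:
  assumes "p \<ge> 2"
  shows "local_density p E \<le> 1"
  using local_density_mono[OF assms, of E UNIV] local_density_UNIV[OF assms] by simp

lemma local_density_Compl:
  assumes "p \<ge> 2"
  shows "local_density p (- E) = 1 - local_density p E"
proof -
  have "local_density p (E \<union> - E) = local_density p E + local_density p (- E)"
    unfolding local_density_def
    by (subst infsum_Un_disjoint)
       (auto intro: summable_on_inverse_powers assms simp: distrib_left)
  then show ?thesis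
    using local_density_UNIV[OF assms] by simp
qed

lemma local_density_singleton_0: "local_density p {0} = 1 - 1 / real p"
  by (simp add: local_density_def)

text \<open>Multiplying the geometric term by \<open>1 - 1 / p\<close> gives the density of the
  multiples of \<open>p ^ e\<close> that are not multiples of \<open>p ^ Suc e\<close>. This is the
  form in which counting by exact exponent produces the density.\<close>

lemma local_density_eq_suminf:
  assumes "p \<ge> 2"
  shows "local_density p E = (\<Sum>e. of_bool (e \<in> E) * (1 / real p ^ e - 1 / real p ^ Suc e))"
proof -
  let ?f = "\<lambda>e. of_bool (e \<in> E) * (1 / real p ^ e)"
  have "((\<lambda>e. 1 / real p ^ e) has_sum (\<Sum>\<^sub>\<infinity>e\<in>E. 1 / real p ^ e)) E"
    using summable_on_inverse_powers[OF assms] by (rule has_sum_infsum)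
  then have "(?f has_sum (\<Sum>\<^sub>\<infinity>e\<in>E. 1 / real p ^ e)) UNIV"
    by (subst has_sum_cong_neutral[where T = E and g = "\<lambda>e. 1 / real p ^ e"]) auto
  then have "(\<lambda>e. (1 - 1 / real p) * ?f e) sums local_density p E"
    unfolding local_density_def by (intro sums_mult has_sum_imp_sums)
  moreover have "(1 - 1 / real p) * ?f e =
      of_bool (e \<in> E) * (1 / real p ^ e - 1 / real p ^ Suc e)" for e
    using assms by (simp add: field_simps)
  ultimately show ?thesis
    by (simp add: sums_iff)
qed

subsection \<open>Independence of exponents at finitely many primes\<close>

lemma tendsto_div_nat:
  assumes "m > 0"
  shows "(\<lambda>N. real (N div m) / real N) \<longlonglongrightarrow> 1 / real m"
proof (rule tendsto_sandwich)
  have le: "real (N div m) \<le> real N / real m" for N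
    by (rule of_nat_div_le_of_nat)
  have ge: "real N / real m - 1 \<le> real (N div m)" for N
    using floor_divide_of_nat_eq[of N m, where ?'a = real] by linarith
  show "\<forall>\<^sub>F N in sequentially. real (N div m) / real N \<le> 1 / real m"
    using eventually_gt_at_top[of 0]
  proof eventually_elim
    case (elim N)
    then show ?case
      using divide_right_mono[OF le[of N], of "real N"] by (simp add: field_simps)
  qed
  show "\<forall>\<^sub>F N in sequentially. 1 / real m - 1 / real N \<le> real (N div m) / real N"
    using eventually_gt_at_top[of 0]
  proof eventually_elim
    case (elim N)
    then show ?case
      using divide_right_mono[OF ge[of N], of "real N"] by (simp add: diff_divide_distrib)
  qed
  show "(\<lambda>N. 1 / real m - 1 / real N) \<longlonglongrightarrow> 1 / real m"
    using tendsto_diff[OF tendsto_const[of "1 / real m"] lim_1_over_n] by simp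
qed auto

lemma has_density_dilate:
  assumes "has_density X \<delta>" "m > 0"
  shows "(\<lambda>N. real (card (X \<inter> {1..N div m})) / real N) \<longlonglongrightarrow> \<delta> / real m"
proof -
  have "filterlim (\<lambda>N. N div m) sequentially sequentially"
    unfolding filterlim_at_top
  proof
    fix Z
    show "\<forall>\<^sub>F N in sequentially. Z \<le> N div m"
      using eventually_ge_at_top[of "Z * m"] assms(2)
      by (auto elim!: eventually_mono simp: less_eq_div_iff_mult_less_eq)
  qed
  then have "(\<lambda>N. real (card (X \<inter> {1..N div m})) / real (N div m)) \<longlonglongrightarrow> \<delta>"
    using assms(1) unfolding has_density_def by (rule filterlim_compose[rotated])
  from tendsto_mult[OF this tendsto_div_nat[OF assms(2)]]
  have "(\<lambda>N. real (card (X \<inter> {1..N div m})) / real (N div m) * (real (N div m) / real N))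
          \<longlonglongrightarrow> \<delta> / real m"
    by simp
  \<comment> \<open>If \<open>N div m = 0\<close>, the counted interval is empty and both sides are
    0, so cancelling is valid for every \<open>N\<close>.\<close>
  moreover have "real (card (X \<inter> {1..N div m})) / real (N div m) * (real (N div m) / real N) =
      real (card (X \<inter> {1..N div m})) / real N" for N
    by simp
  ultimately show ?thesis
    by (simp only:)
qed

text \<open>Multiplication by \<open>m\<close> maps the members of \<open>X\<close> up to
  \<open>N div m\<close> bijectively onto the counted multiples.\<close>

lemma card_multiples:
  fixes m :: nat
  assumes "m > 0" "\<And>n. n > 0 \<Longrightarrow> m * n \<in> X \<longleftrightarrow> n \<in> X"
  shows "card {n \<in> X \<inter> {1..N}. m dvd n} = card (X \<inter> {1..N div m})"
proof -
  have "bij_betw (\<lambda>n. m * n) (X \<inter> {1..N div m}) {n \<in> X \<inter> {1..N}. m dvd n}"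
    unfolding bij_betw_def
  proof
    show "inj_on (\<lambda>n. m * n) (X \<inter> {1..N div m})"
      using assms(1) by (simp add: inj_on_def)
    show "(\<lambda>n. m * n) ` (X \<inter> {1..N div m}) = {n \<in> X \<inter> {1..N}. m dvd n}"
    proof (intro equalityI subsetI)
      fix n assume n: "n \<in> {n \<in> X \<inter> {1..N}. m dvd n}"
      then obtain k where k: "n = m * k"
        by auto
      then have "k \<in> X \<inter> {1..N div m}"
        using n assms by (auto simp: less_eq_div_iff_mult_less_eq mult.commute Suc_le_eq)
      then show "n \<in> (\<lambda>n. m * n) ` (X \<inter> {1..N div m})"
        using k by blast
    qed (use assms in \<open>auto simp: less_eq_div_iff_mult_less_eq mult.commute Suc_le_eq\<close>)
  qed
  then show ?thesis
    by (simp add: bij_betw_same_card)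
qed

text \<open>Invariance under multiplication by \<open>p\<close> expresses that \<open>X\<close> puts
  no condition on the exponent at \<open>p\<close>. The multiples of \<open>p ^ e\<close> in
  \<open>X\<close> are then a dilated copy of \<open>X\<close>, and differences of such counts give
  the density of each exact exponent \<open>e\<close>.\<close>

lemma has_density_multiplicity:
  assumes X: "has_density X \<delta>" and p: "prime p"
    and invariant: "\<And>n. n > 0 \<Longrightarrow> p * n \<in> X \<longleftrightarrow> n \<in> X"
  shows "has_density {n \<in> X. multiplicity p n \<in> E} (local_density p E * \<delta>)"
proof -
  have p2: "p \<ge> 2"
    using p by (rule prime_ge_2_nat)
  define F where "F = (\<lambda>N. card (X \<inter> {1..N}))"
  define L where "L = (\<lambda>e N. {n \<in> X \<inter> {1..N}. multiplicity p n = e})"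
  have inv: "p ^ e * n \<in> X \<longleftrightarrow> n \<in> X" if "n > 0" for e n
    using that invariant[of "p ^ _ * n"] p2 by (induction e) (auto simp: mult.assoc)
  have F: "card {n \<in> X \<inter> {1..N}. p ^ e dvd n} = F (N div p ^ e)" for e N
    unfolding F_def using p2 inv by (intro card_multiples) auto
  have L: "real (card (L e N)) = real (F (N div p ^ e)) - real (F (N div p ^ Suc e))" for e N
  proof -
    have "{n \<in> X \<inter> {1..N}. p ^ e dvd n} = L e N \<union> {n \<in> X \<inter> {1..N}. p ^ Suc e dvd n}"
      using p p2 unfolding L_def
      by (auto simp: power_dvd_iff_le_multiplicity simp del: power_Suc)
    moreover have "L e N \<inter> {n \<in> X \<inter> {1..N}. p ^ Suc e dvd n} = {}"
      using p p2 unfolding L_def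
      by (auto simp: power_dvd_iff_le_multiplicity simp del: power_Suc)
    ultimately have "F (N div p ^ e) = card (L e N) + F (N div p ^ Suc e)"
      unfolding F[symmetric] by (simp add: card_Un_disjoint L_def)
    then show ?thesis
      by simp
  qed
  let ?a = "\<lambda>e N. of_bool (e \<in> E) * (real (card (L e N)) / real N)"
  let ?b = "\<lambda>e. \<delta> * (of_bool (e \<in> E) * (1 / real p ^ e - 1 / real p ^ Suc e))"
  have lim: "?a e \<longlonglongrightarrow> ?b e" for e
  proof -
    have "(\<lambda>N. of_bool (e \<in> E) *
            (real (F (N div p ^ e)) / real N - real (F (N div p ^ Suc e)) / real N))
        \<longlonglongrightarrow> of_bool (e \<in> E) * (\<delta> / real (p ^ e) - \<delta> / real (p ^ Suc e))"
      unfolding F_def using p2 by (intro tendsto_intros has_density_dilate X) auto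
    then show ?thesis
      by (simp add: L diff_divide_distrib algebra_simps)
  qed
  have bound: "norm (?a e N) \<le> 1 / real p ^ e" for e N
  proof -
    have "F (N div p ^ e) \<le> N div p ^ e"
      using card_mono[of "{1..N div p ^ e}" "X \<inter> {1..N div p ^ e}"] by (simp add: F_def)
    then have "real (F (N div p ^ e)) \<le> real N / real p ^ e"
      using of_nat_div_le_of_nat[of N "p ^ e", where ?'a = real] unfolding of_nat_power by linarith
    then have "real (card (L e N)) \<le> real N / real p ^ e"
      using L[of e N] by linarith
    then show ?thesis
      using p2 by (cases "N = 0") (auto simp: field_simps)
  qed
  \<comment> \<open>Natural density is not countably additive. The sum over \<open>e\<close> and the
    limit in \<open>N\<close> may be exchanged because \<open>1 / p ^ e\<close> is a summable bound
    independent of \<open>N\<close>.\<close>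
  have "(\<lambda>N. \<Sum>e. ?a e N) \<longlonglongrightarrow> suminf ?b"
  proof (rule tannerys_theorem[where M = "\<lambda>e. 1 / real p ^ e", THEN conjunct2, THEN conjunct2])
    show "\<forall>\<^sub>F (e, N) in at_top \<times>\<^sub>F sequentially. norm (?a e N) \<le> 1 / real p ^ e"
      using bound by (intro always_eventually) auto
    show "summable (\<lambda>e. 1 / real p ^ e)"
      using sums_inverse_powers[OF p2] by (simp add: sums_iff)
  qed (use lim in auto)
  moreover have "suminf ?b = local_density p E * \<delta>"
  proof -
    have "summable (\<lambda>e. of_bool (e \<in> E) * (1 / real p ^ e - 1 / real p ^ Suc e))"
    proof (rule summable_comparison_test')
      show "summable (\<lambda>e. 1 / real p ^ e)"
        using sums_inverse_powers[OF p2] by (simp add: sums_iff)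
    qed (use p2 in \<open>auto simp: field_simps\<close>)
    then show ?thesis
      by (simp only: suminf_mult local_density_eq_suminf[OF p2] mult.commute)
  qed
  moreover have "(\<Sum>e. ?a e N) = real (card ({n \<in> X. multiplicity p n \<in> E} \<inter> {1..N})) / real N" for N
  proof -
    \<comment> \<open>For fixed \<open>N\<close> only exponents below \<open>N\<close> occur, so the
      series over \<open>e\<close> is a finite sum.\<close>
    have small: "multiplicity p n < N" if "n \<in> {1..N}" for n
    proof -
      have "multiplicity p n < p ^ multiplicity p n"
        using p2 by (simp add: power_gt_expt)
      also have "\<dots> \<le> n"
        using that by (intro dvd_imp_le multiplicity_dvd) auto
      finally show ?thesis
        using that by simp
    qed
    have "(\<Sum>e. ?a e N) = (\<Sum>e<N. ?a e N)"
    proof (rule suminf_finite)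
      fix e assume "e \<notin> {..<N}"
      then have "L e N = {}"
        using small unfolding L_def by force
      then show "?a e N = 0"
        by simp
    qed auto
    also have "\<dots> = (\<Sum>e\<in>E \<inter> {..<N}. real (card (L e N)) / real N)"
      by (intro sum.mono_neutral_cong_right) auto
    also have "\<dots> = real (card (\<Union>e\<in>E \<inter> {..<N}. L e N)) / real N"
      by (subst card_UN_disjoint) (auto simp: L_def sum_divide_distrib)
    also have "(\<Union>e\<in>E \<inter> {..<N}. L e N) = {n \<in> X. multiplicity p n \<in> E} \<inter> {1..N}"
      using small by (auto simp: L_def)
    finally show ?thesis .
  qed
  ultimately show ?thesis
    by (simp add: has_density_def)
qed

lemma multiplicity_times_distinct_prime:
  fixes p r n :: nat
  assumes "prime p" "prime r" "p \<noteq> r" "n > 0"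
  shows "multiplicity r (p * n) = multiplicity r n"
  using assms
  by (subst prime_elem_multiplicity_mult_distrib) (auto simp: prime_multiplicity_other)

text \<open>Primes are added one at a time: multiplying by a new prime leaves the exponents at the
  earlier ones unchanged, which is the invariance required by
  \<open>has_density_multiplicity\<close>.\<close>

lemma has_density_multiplicity_finite:
  assumes "finite P" "\<And>p. p \<in> P \<Longrightarrow> prime p"
  shows "has_density {n. n > 0 \<and> (\<forall>p\<in>P. multiplicity p n \<in> E p)} (\<Prod>p\<in>P. local_density p (E p))"
  using assms
proof (induction P rule: finite_induct)
  case empty
  \<comment> \<open>Only eventually, since at \<open>N = 0\<close> the quotient is 0.\<close>
  have "\<forall>\<^sub>F N in sequentially. 1 = real (card ({n. n > 0} \<inter> {1..N})) / real N"
    using eventually_gt_at_top[of 0]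
  proof eventually_elim
    case (elim N)
    have "{n. n > 0} \<inter> {1..N} = {1..N}"
      by auto
    then show ?case
      using elim by simp
  qed
  then have "(\<lambda>N. real (card ({n. n > 0} \<inter> {1..N})) / real N) \<longlonglongrightarrow> 1"
    by (rule Lim_transform_eventually[OF tendsto_const])
  then show ?case
    by (simp add: has_density_def)
next
  case (insert p P)
  let ?X = "{n. n > 0 \<and> (\<forall>r\<in>P. multiplicity r n \<in> E r)}"
  have "multiplicity r (p * n) = multiplicity r n" if "r \<in> P" "n > 0" for r n
    using that insert.hyps insert.prems by (intro multiplicity_times_distinct_prime) auto
  then have "p * n \<in> ?X \<longleftrightarrow> n \<in> ?X" if "n > 0" for n
    using that insert.prems[of p] by (auto simp: prime_gt_0_nat)
  then have "has_density {n \<in> ?X. multiplicity p n \<in> E p}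
      (local_density p (E p) * (\<Prod>r\<in>P. local_density r (E r)))"
    using insert by (intro has_density_multiplicity) auto
  moreover have "{n \<in> ?X. multiplicity p n \<in> E p} =
      {n. n > 0 \<and> (\<forall>r\<in>insert p P. multiplicity r n \<in> E r)}"
    by auto
  ultimately show ?case
    using insert.hyps by simp
qed

subsection \<open>Conditions at all primes\<close>

lemma sum_inverse_squares_le:
  assumes "y > 0"
  shows "(\<Sum>k\<in>{y<..N}. 1 / real k ^ 2) \<le> 1 / real y"
proof (cases "y \<le> N")
  case True
  \<comment> \<open>The subtracted \<open>1 / N\<close> makes the induction telescope, as 1/(N+1)^2
    \<le> 1/N - 1/(N+1).\<close>
  then have "(\<Sum>k\<in>{y<..N}. 1 / real k ^ 2) \<le> 1 / real y - 1 / real N"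
  proof (induction N rule: dec_induct)
    case (step N)
    have "{y<..Suc N} = insert (Suc N) {y<..N}"
      using step.hyps by auto
    then have "(\<Sum>k\<in>{y<..Suc N}. 1 / real k ^ 2) \<le>
        1 / real (Suc N) ^ 2 + (1 / real y - 1 / real N)"
      using step.IH by simp
    moreover have "1 / real (Suc N) ^ 2 \<le> 1 / real N - 1 / real (Suc N)"
    proof -
      have "1 / real (Suc N) ^ 2 \<le> 1 / (real N * real (Suc N))"
        using step.hyps assms by (intro divide_left_mono) (auto simp: power2_eq_square)
      also have "\<dots> = 1 / real N - 1 / real (Suc N)"
        using step.hyps assms by (simp add: field_simps)
      finally show ?thesis .
    qed
    ultimately show ?case
      by linarith
  qed auto
  moreover have "0 \<le> 1 / real N"
    by simp
  ultimately show ?thesis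
    by linarith
qed auto

text \<open>Truncating the conditions to primes up to \<open>y\<close> changes every counting ratio
  by at most \<open>1 / y\<close>, uniformly in \<open>N\<close>, so the limits in \<open>y\<close>
  and \<open>N\<close> can be interchanged. The threshold \<open>y0\<close> leaves room for finitely
  many primes with stricter conditions, such as exponent 0 at \<open>q\<close>.\<close>

lemma has_density_multiplicity_all:
  assumes E: "\<And>p. prime p \<Longrightarrow> p > y0 \<Longrightarrow> {0, 1} \<subseteq> E p"
    and D: "(\<lambda>y. \<Prod>p | prime p \<and> p \<le> y. local_density p (E p)) \<longlonglongrightarrow> D"
  shows "has_density {n. n > 0 \<and> (\<forall>p. prime p \<longrightarrow> multiplicity p n \<in> E p)} D"
proof -
  define C where "C = {n. n > 0 \<and> (\<forall>p. prime p \<longrightarrow> multiplicity p n \<in> E p)}"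
  define X where "X = (\<lambda>y. {n. n > 0 \<and> (\<forall>p\<in>{p. prime p \<and> p \<le> y}. multiplicity p n \<in> E p)})"
  define c where "c = (\<lambda>N. real (card (C \<inter> {1..N})) / real N)"
  define x where "x = (\<lambda>y N. real (card (X y \<inter> {1..N})) / real N)"
  have tail: "\<bar>x y N - c N\<bar> \<le> 1 / real y" if y: "y > 0" "y \<ge> y0" for y N
  proof -
    have "C \<subseteq> X y"
      by (auto simp: C_def X_def)
    then have lower: "card (C \<inter> {1..N}) \<le> card (X y \<inter> {1..N})"
      by (intro card_mono) auto
    \<comment> \<open>An element of \<open>X y\<close> outside \<open>C\<close> fails at some prime
      above \<open>y\<close>, where its exponent is at least 2. The union runs over all integers
      \<open>k\<close>, not just primes, which suffices for the bound; the redundant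
      \<open>UNIV\<close> matches the form of \<open>card_multiples\<close>.\<close>
    have "X y \<inter> {1..N} \<subseteq> (C \<inter> {1..N}) \<union> (\<Union>k\<in>{y<..N}. {n \<in> UNIV \<inter> {1..N}. k ^ 2 dvd n})"
    proof
      fix n assume n: "n \<in> X y \<inter> {1..N}"
      show "n \<in> (C \<inter> {1..N}) \<union> (\<Union>k\<in>{y<..N}. {n \<in> UNIV \<inter> {1..N}. k ^ 2 dvd n})"
      proof (cases "n \<in> C")
        case False
        then obtain p where p: "prime p" "multiplicity p n \<notin> E p"
          using n by (auto simp: C_def)
        have "\<not> p \<le> y"
          using n p unfolding X_def by blast
        then have "p > y"
          by simp
        then have "{0, 1} \<subseteq> E p"
          using E p(1) y by auto
        then have "multiplicity p n \<noteq> 0" "multiplicity p n \<noteq> 1"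
          using p(2) by (metis insertI1 insertI2 subsetD)+
        then have dvd: "p ^ 2 dvd n"
          by (intro multiplicity_dvd') linarith
        then have "p ^ 2 \<le> n"
          using n by (intro dvd_imp_le) auto
        then have "p \<le> N"
          using n power2_nat_le_imp_le[of p n] by auto
        then show ?thesis
          using \<open>p > y\<close> dvd n by auto
      qed (use n in auto)
    qed
    then have "card (X y \<inter> {1..N}) \<le>
        card ((C \<inter> {1..N}) \<union> (\<Union>k\<in>{y<..N}. {n \<in> UNIV \<inter> {1..N}. k ^ 2 dvd n}))"
      by (intro card_mono) auto
    also have "\<dots> \<le> card (C \<inter> {1..N}) + (\<Sum>k\<in>{y<..N}. card {n \<in> UNIV \<inter> {1..N}. k ^ 2 dvd n})"
      by (intro order.trans[OF card_Un_le] add_left_mono card_UN_le) auto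
    also have "(\<Sum>k\<in>{y<..N}. card {n \<in> UNIV \<inter> {1..N}. k ^ 2 dvd n}) = (\<Sum>k\<in>{y<..N}. N div k ^ 2)"
      by (intro sum.cong refl, subst card_multiples) auto
    finally have "real (card (X y \<inter> {1..N})) - real (card (C \<inter> {1..N})) \<le>
        (\<Sum>k\<in>{y<..N}. real (N div k ^ 2))"
      by (simp flip: of_nat_sum)
    also have "\<dots> \<le> (\<Sum>k\<in>{y<..N}. real N * (1 / real k ^ 2))"
      using of_nat_div_le_of_nat[of N "_ ^ 2"] by (intro sum_mono) simp
    also have "\<dots> \<le> real N * (1 / real y)"
      unfolding sum_distrib_left[symmetric]
      by (intro mult_left_mono sum_inverse_squares_le y) auto
    finally have upper: "real (card (X y \<inter> {1..N})) - real (card (C \<inter> {1..N})) \<le> real N / real y"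
      by simp
    have "\<bar>x y N - c N\<bar> = (real (card (X y \<inter> {1..N})) - real (card (C \<inter> {1..N}))) / real N"
      using lower by (simp add: x_def c_def abs_if divide_simps)
    also have "\<dots> \<le> real N / real y / real N"
      using upper by (rule divide_right_mono) simp
    \<comment> \<open>An inequality because at \<open>N = 0\<close> the left side is 0.\<close>
    also have "\<dots> \<le> 1 / real y"
      by simp
    finally show ?thesis .
  qed
  have "c \<longlonglongrightarrow> D"
  proof (rule swap_uniform_limit')
    show "(\<lambda>y. \<Prod>p | prime p \<and> p \<le> y. local_density p (E p)) \<longlonglongrightarrow> D"
      by (fact D)
    have "has_density (X y) (\<Prod>p | prime p \<and> p \<le> y. local_density p (E p))" for y
      unfolding X_def by (rule has_density_multiplicity_finite) auto
    then have "x y \<longlonglongrightarrow> (\<Prod>p | prime p \<and> p \<le> y. local_density p (E p))" for y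
      unfolding has_density_def x_def .
    then show "\<forall>\<^sub>F y in sequentially.
        (x y \<longlongrightarrow> (\<Prod>p | prime p \<and> p \<le> y. local_density p (E p))) sequentially"
      by simp
    show "uniform_limit (UNIV :: nat set) x c sequentially"
    proof (rule uniform_limitI)
      fix \<epsilon> :: real assume "\<epsilon> > 0"
      then have "\<forall>\<^sub>F y in sequentially. 1 / real y < \<epsilon>"
        using lim_1_over_n by (rule order_tendstoD(2)[rotated])
      then show "\<forall>\<^sub>F y in sequentially. \<forall>N\<in>UNIV. dist (x y N) (c N) < \<epsilon>"
        using eventually_gt_at_top[of 0] eventually_ge_at_top[of y0]
      proof eventually_elim
        case (elim y)
        show ?case
        proof
          fix N
          show "dist (x y N) (c N) < \<epsilon>"
            using tail[OF elim(2,3), of N] elim(1) by (simp add: dist_real_def)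
        qed
      qed
    qed
    show "\<forall>\<^sub>F N in sequentially. N \<in> UNIV"
      by simp
    show "sequentially \<noteq> bot"
      by simp
  qed
  then show ?thesis
    unfolding has_density_def c_def C_def .
qed

subsection \<open>The density of \<open>M q\<close>\<close>

text \<open>One level of the recursion: the exponent at a prime factor is positive, so containing
  \<open>q\<close> in its tower is the same as lying in \<open>M q\<close>.\<close>

lemma mem_M_iff:
  "n \<in> M q \<longleftrightarrow> n > 0 \<and> (\<exists>p\<in>prime_factors n. p = q \<or> multiplicity p n \<in> M q)"
proof -
  have "multiplicity p n > 0" if "p \<in> prime_factors n" for p
    using that by (simp add: prime_factors_multiplicity)
  then show ?thesis
    unfolding M_def by (subst tower_primes_tower_factorization) blast
qed

lemma zero_one_notin_M: "0 \<notin> M q" "1 \<notin> M q"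
  by (subst mem_M_iff; simp)+

text \<open>Since \<open>0\<close> lies in both \<open>{0}\<close> and \<open>Mc q\<close>, primes
  not dividing \<open>n\<close> satisfy the condition automatically, and the quantifier can range
  over all primes.\<close>

lemma not_mem_M_iff:
  assumes "prime q" "n > 0"
  shows "n \<notin> M q \<longleftrightarrow>
    (\<forall>p. prime p \<longrightarrow> multiplicity p n \<in> (if p = q then {0} else Mc q))"
proof -
  have prime_factors: "p \<in> prime_factors n \<longleftrightarrow> prime p \<and> multiplicity p n \<noteq> 0" for p
    using assms(2) by (auto simp: prime_factors_multiplicity)
  have "n \<in> M q \<longleftrightarrow>
      (\<exists>p. prime p \<and> multiplicity p n \<noteq> 0 \<and> (p = q \<or> multiplicity p n \<in> M q))"
    by (subst mem_M_iff) (use assms(2) prime_factors in blast)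
  also have "\<dots> \<longleftrightarrow> (\<exists>p. prime p \<and> multiplicity p n \<notin> (if p = q then {0} else Mc q))"
    using zero_one_notin_M(1)[of q] by (intro ex_cong1) (auto simp: Mc_def intro!: gr0I)
  finally show ?thesis
    by blast
qed

text \<open>The condition at \<open>q\<close> admits only exponent 0 and contributes the factor
  \<open>1 - 1 / q\<close>; every other prime contributes the local density of \<open>Mc q\<close>.
  The proof also shows that the limit defining \<open>d q\<close> exists.\<close>

lemma d_eq:
  assumes "prime q"
  shows "d q = 1 - (1 - 1 / real q) * prime_prod_except q (\<lambda>p. local_density p (Mc q))"
proof -
  let ?L = "prime_prod_except q (\<lambda>p. local_density p (Mc q))"
  define E where "E = (\<lambda>p. if p = q then {0} else Mc q)"
  define C where "C = {n. n > 0 \<and> (\<forall>p. prime p \<longrightarrow> multiplicity p n \<in> E p)}"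
  have "(\<lambda>y. (1 - 1 / real q) * (\<Prod>p | prime p \<and> p \<noteq> q \<and> p \<le> y. local_density p (Mc q)))
      \<longlonglongrightarrow> (1 - 1 / real q) * ?L"
    by (intro tendsto_mult_left prime_prod_except_convergent)
       (simp add: local_density_nonneg local_density_le_1 prime_ge_2_nat)
  moreover have "\<forall>\<^sub>F y in sequentially.
      (1 - 1 / real q) * (\<Prod>p | prime p \<and> p \<noteq> q \<and> p \<le> y. local_density p (Mc q)) =
      (\<Prod>p | prime p \<and> p \<le> y. local_density p (E p))"
    \<comment> \<open>The factor at \<open>q\<close> enters the partial product only once
      \<open>y\<close> reaches \<open>q\<close>.\<close>
    using eventually_ge_at_top[of q]
  proof eventually_elim
    case (elim y)
    have "{p. prime p \<and> p \<le> y} = insert q {p. prime p \<and> p \<noteq> q \<and> p \<le> y}"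
      using assms elim by auto
    then show ?case
      by (simp add: E_def local_density_singleton_0)
  qed
  ultimately have "(\<lambda>y. \<Prod>p | prime p \<and> p \<le> y. local_density p (E p))
      \<longlonglongrightarrow> (1 - 1 / real q) * ?L"
    by (rule Lim_transform_eventually)
  then have "has_density C ((1 - 1 / real q) * ?L)"
    unfolding C_def using zero_one_notin_M
    by (intro has_density_multiplicity_all[of q]) (auto simp: E_def Mc_def)
  then have "(\<lambda>N. 1 - real (card (C \<inter> {1..N})) / real N) \<longlonglongrightarrow> 1 - (1 - 1 / real q) * ?L"
    unfolding has_density_def by (intro tendsto_intros)
  moreover have "\<forall>\<^sub>F N in sequentially. 1 - real (card (C \<inter> {1..N})) / real N =
      real (card (M q \<inter> {1..N})) / real N"
    \<comment> \<open>At \<open>N = 0\<close> the two sides are 1 and 0.\<close>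
    using eventually_gt_at_top[of 0]
  proof eventually_elim
    case (elim N)
    have "C = {n. n > 0 \<and> n \<notin> M q}"
      unfolding C_def E_def using not_mem_M_iff[OF assms] by (intro Collect_cong) blast
    then have "C \<inter> {1..N} = {1..N} - M q \<inter> {1..N}"
      by auto
    then have "card (C \<inter> {1..N}) = N - card (M q \<inter> {1..N})"
      by (simp add: card_Diff_subset)
    moreover have "card (M q \<inter> {1..N}) \<le> N"
      using card_mono[of "{1..N}" "M q \<inter> {1..N}"] by simp
    ultimately show ?case
      using elim by (simp add: of_nat_diff field_simps)
  qed
  ultimately have "(\<lambda>N. real (card (M q \<inter> {1..N})) / real N)
      \<longlonglongrightarrow> 1 - (1 - 1 / real q) * ?L"
    by (rule Lim_transform_eventually)
  then show ?thesis
    unfolding d_def by (rule limI)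
qed

text \<open>Factors in [0, 1] make both sequences of partial products converge, so the termwise
  comparison passes to the limits.\<close>

lemma prime_prod_except_mono:
  assumes "\<And>p. prime p \<Longrightarrow> p \<noteq> q \<Longrightarrow> 0 \<le> F p \<and> F p \<le> G p \<and> G p \<le> 1"
  shows "prime_prod_except q F \<le> prime_prod_except q G"
proof (rule LIMSEQ_le)
  show "(\<lambda>N. \<Prod>p | prime p \<and> p \<noteq> q \<and> p \<le> N. F p) \<longlonglongrightarrow> prime_prod_except q F"
    using assms by (intro prime_prod_except_convergent) (meson order.trans)
  show "(\<lambda>N. \<Prod>p | prime p \<and> p \<noteq> q \<and> p \<le> N. G p) \<longlonglongrightarrow> prime_prod_except q G"
    using assms by (intro prime_prod_except_convergent) (meson order.trans)
  show "\<exists>N0. \<forall>N\<ge>N0. (\<Prod>p | prime p \<and> p \<noteq> q \<and> p \<le> N. F p) \<le>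
      (\<Prod>p | prime p \<and> p \<noteq> q \<and> p \<le> N. G p)"
    using assms by (auto intro!: prod_mono)
qed

theorem theorem3:
  fixes q :: nat and S T A B :: "nat \<Rightarrow> nat set"
  assumes "prime q"
    and "\<And>p. prime p \<Longrightarrow> p \<noteq> q \<Longrightarrow> S p \<subseteq> M q \<and> M q \<subseteq> T p"
    and "\<And>p. prime p \<Longrightarrow> p \<noteq> q \<Longrightarrow> A p \<subseteq> Mc q \<and> Mc q \<subseteq> B p"
  shows "d q \<ge> 1 - (1 - 1 / real q) *
           prime_prod_except q (\<lambda>p. 1 - (1 - 1 / real p) * (\<Sum>\<^sub>\<infinity>s\<in>S p. 1 / real p ^ s))
   \<and> d q \<le> 1 - (1 - 1 / real q) *
           prime_prod_except q (\<lambda>p. 1 - (1 - 1 / real p) * (\<Sum>\<^sub>\<infinity>t\<in>T p. 1 / real p ^ t))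
   \<and> d q \<le> 1 - (1 - 1 / real q) *
           prime_prod_except q (\<lambda>p. (1 - 1 / real p) * (\<Sum>\<^sub>\<infinity>a\<in>A p. 1 / real p ^ a))
   \<and> d q \<ge> 1 - (1 - 1 / real q) *
           prime_prod_except q (\<lambda>p. (1 - 1 / real p) * (\<Sum>\<^sub>\<infinity>b\<in>B p. 1 / real p ^ b))"
proof -
  have "1 - 1 / real q \<ge> 0"
    using prime_ge_2_nat[OF assms(1)] by simp
  \<comment> \<open>Larger factors give a larger product and hence a smaller value of one minus the
    product.\<close>
  then have step: "1 - (1 - 1 / real q) * prime_prod_except q G \<le>
      1 - (1 - 1 / real q) * prime_prod_except q F"
    if "\<And>p. prime p \<Longrightarrow> p \<noteq> q \<Longrightarrow> 0 \<le> F p \<and> F p \<le> G p \<and> G p \<le> 1" for F G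
    using prime_prod_except_mono[of q F G] that by (intro diff_left_mono mult_left_mono) auto
  have "Mc q = - M q"
    by (auto simp: Mc_def)
  \<comment> \<open>The first two bounds compare \<open>1 - local_density p (M q)\<close> with the
    same expression for \<open>S p\<close> and \<open>T p\<close>; the last two compare the local
    density of \<open>Mc q\<close> with those of \<open>A p\<close> and \<open>B p\<close>.\<close>
  then have Mc: "local_density p (Mc q) = 1 - local_density p (M q)" if "prime p" for p
    using local_density_Compl[OF prime_ge_2_nat[OF that]] by simp
  note bounds = prime_ge_2_nat local_density_nonneg local_density_le_1 local_density_mono
  show ?thesis
    unfolding d_eq[OF assms(1)] local_density_def[symmetric]
    using assms(2,3) by (intro conjI step) (simp_all add: bounds flip: Mc, simp_all add: bounds Mc)
qed

end
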